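(* Let $s=\sigma+it$ with $0\le\sigma<1$ and $t>0$. Then, as $t\to\infty$, $$\sum_{m=1}^{[t]}\sum_{n=1}^{[t]}\frac{1}{m^{s}n^{\bar s}}=\begin{cases}O\left(t^{\frac32-\frac53\sigma}\ln t\right), & 0\le\sigma\le\frac12,\\[2mm] O\left(t^{\frac43-\frac43\sigma}\ln t\right), & \frac12<\sigma<1.\end{cases}$$
   Context: $[A]$ denotes the integer part of $A$, and $\bar s=\sigma-it$ is the complex conjugate of $s$. The parameter $\sigma$ is fixed, and the $O$-statements are for real $t\to\infty$ (implied constants may depend on $\sigma$). *)

theory Defs
  imports "HOL-Analysis.Analysis" "HOL-Library.Landau_Symbols"
begin

end

theory Submission
  imports Defs
begin

text \<open>
  The double sum is the square of the modulus of the sum of \<open>n powr - s\<close> over \<open>n \<le> t\<close>, and the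
  latter is bounded by a constant times \<open>t powr ((1 - \<sigma>) / 2) * ln t\<close>; since \<open>1 - \<sigma>\<close> is
  strictly below both exponents of the claim, the extra logarithm is absorbed.
  The terms \<open>n < sqrt t\<close> are estimated trivially. For \<open>n \<ge> sqrt t\<close> the phase increments
  \<open>t * ln ((n + 1) / n)\<close> of \<open>n powr (- i t)\<close> decrease in \<open>n\<close>; the terms are grouped according to the
  integer part \<open>k\<close> of the increment divided by \<open>2 pi\<close>. Within a group, the few terms whose
  increment is close to a multiple of \<open>2 pi\<close> are counted, and the remaining ones form an interval to
  which the Kusmin-Landau inequality applies. Group \<open>k\<close> contributes \<open>O(sqrt t / (k + 1) + 1)\<close> and
  \<open>k \<le> sqrt t\<close>, so the sum of \<open>n powr (- i t)\<close> is \<open>O(sqrt t * ln t)\<close>, and the weights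
  \<open>n powr - \<sigma>\<close> are inserted by partial summation.
\<close>

section \<open>Partial summation with monotone weights\<close>

text \<open>Abel summation by induction on the upper end: from \<open>m\<close> to
  \<open>Suc m\<close>, the sum minus \<open>a m * S m\<close> changes by the increment of
  \<open>a\<close> times \<open>S m\<close>. By monotonicity the increments total at most
  \<open>2 * A\<close>; the boundary term adds one more \<open>A\<close>.\<close>

lemma norm_sum_monotone_weight_le:
  fixes a :: "nat \<Rightarrow> real" and w :: "nat \<Rightarrow> complex"
  assumes "p \<le> q"
    and "\<And>m n. p \<le> m \<Longrightarrow> m \<le> n \<Longrightarrow> n \<le> q \<Longrightarrow> a m \<le> a n"
    and "\<And>n. p \<le> n \<Longrightarrow> n \<le> q \<Longrightarrow> \<bar>a n\<bar> \<le> A"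
    and W: "\<And>m. p \<le> m \<Longrightarrow> m \<le> q \<Longrightarrow> norm (\<Sum>n=p..m. w n) \<le> W"
  shows "norm (\<Sum>n=p..q. of_real (a n) * w n) \<le> 3 * A * W"
proof -
  define S where "S m = (\<Sum>n=p..m. w n)" for m
  have W0: "0 \<le> W" using W[of p] assms(1) norm_ge_zero order_trans by blast
  have key: "norm ((\<Sum>n=p..m. of_real (a n) * w n) - of_real (a m) * S m) \<le> (a m - a p) * W"
    if "p \<le> m" "m \<le> q" for m
    using that
  proof (induction m rule: dec_induct)
    case base
    then show ?case by (simp add: S_def)
  next
    case (step m)
    have eq: "(\<Sum>n=p..Suc m. of_real (a n) * w n) - of_real (a (Suc m)) * S (Suc m)
       = ((\<Sum>n=p..m. of_real (a n) * w n) - of_real (a m) * S m) - of_real (a (Suc m) - a m) * S m"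
      using step.hyps by (simp add: S_def algebra_simps)
    have inc: "a m \<le> a (Suc m)" using assms(2)[of m "Suc m"] step by auto
    have "norm (of_real (a (Suc m) - a m) * S m) \<le> (a (Suc m) - a m) * W"
      unfolding norm_mult norm_of_real S_def using inc W[of m] step by (auto intro!: mult_left_mono)
    then have "norm ((\<Sum>n=p..Suc m. of_real (a n) * w n) - of_real (a (Suc m)) * S (Suc m))
      \<le> (a m - a p) * W + (a (Suc m) - a m) * W"
      unfolding eq by (intro norm_triangle_le_diff add_mono step.IH) (use step in auto)
    then show ?case by (simp add: algebra_simps)
  qed
  have "norm (of_real (a q) * S q) \<le> A * W"
    unfolding norm_mult norm_of_real S_def using assms(1) W0
    by (intro mult_mono assms(3) W) (auto intro: order_trans[OF abs_ge_zero assms(3)[of q]])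
  moreover have "(a q - a p) * W \<le> 2 * A * W"
    using assms(3)[of p] assms(3)[of q] assms(1) W0 by (intro mult_right_mono) auto
  ultimately show ?thesis
    using key[of q] assms(1)
      norm_triangle_sub[of "\<Sum>n=p..q. of_real (a n) * w n" "of_real (a q) * S q"]
    by auto
qed

section \<open>Cotangent estimates and the Kusmin-Landau inequality\<close>

lemma mult_cos_le_sin:
  fixes x :: real
  assumes "0 \<le> x" "x \<le> pi"
  shows "x * cos x \<le> sin x"
proof -
  let ?f = "\<lambda>x::real. sin x - x * cos x"
  have "(?f has_real_derivative y * sin y) (at y)" for y
    by (auto intro!: derivative_eq_intros)
  moreover have "0 \<le> y * sin y" if "0 \<le> y" "y \<le> x" for y
    using that assms by (intro mult_nonneg_nonneg sin_ge_zero) auto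
  ultimately have "?f 0 \<le> ?f x"
    using DERIV_nonneg_imp_nondecreasing[of 0 x ?f] assms(1) by blast
  then show ?thesis by simp
qed

text \<open>The range is symmetric under \<open>x\<close> to \<open>pi - x\<close>, which flips the
  sign of \<open>cos x\<close>, so one one-sided inequality used at both points covers both
  signs.\<close>

lemma abs_cot_le_inverse:
  fixes x \<theta> :: real
  assumes "0 < \<theta>" "\<theta> \<le> x" "x \<le> pi - \<theta>"
  shows "\<bar>cot x\<bar> \<le> 1 / \<theta>"
proof -
  have s: "0 < sin x" using assms by (intro sin_gt_zero) auto
  have *: "\<theta> * cos y \<le> sin y" if "\<theta> \<le> y" "y \<le> pi - \<theta>" for y
  proof (cases "0 \<le> cos y")
    case True
    then have "\<theta> * cos y \<le> y * cos y" using that by (intro mult_right_mono)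
    then show ?thesis using mult_cos_le_sin[of y] that assms by simp
  next
    case False
    then have "\<theta> * cos y \<le> 0" using assms by (simp add: mult_le_0_iff)
    moreover have "0 \<le> sin y" using that assms by (intro sin_ge_zero) auto
    ultimately show ?thesis by simp
  qed
  have "\<theta> * \<bar>cos x\<bar> \<le> sin x"
    using *[of x] *[of "pi - x"] assms by (auto simp: abs_if)
  then show ?thesis using s assms by (simp add: cot_def abs_divide field_simps)
qed

lemma cot_antimono:
  fixes x y :: real
  assumes "0 < x" "x \<le> y" "y < pi"
  shows "cot y \<le> cot x"
proof -
  have "0 < sin x" "0 < sin y" using assms by (auto intro: sin_gt_zero)
  moreover have "0 \<le> sin (y - x)" using assms by (intro sin_ge_zero) auto
  ultimately show ?thesis by (simp add: cot_def field_simps sin_diff)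
qed

text \<open>The identity \<open>1 / (1 - exp (- 2 i \<psi>)) = 1/2 - (i/2) cot \<psi>\<close> writes \<open>z\<close> as a telescoping
  difference with weights whose only varying part is monotone.\<close>
lemma kusmin_landau:
  fixes z :: "nat \<Rightarrow> complex" and \<psi> :: "nat \<Rightarrow> real"
  assumes "p \<le> q" "0 < \<theta>"
    and nz: "\<And>n. norm (z n) = 1"
    and step: "\<And>n. p \<le> n \<Longrightarrow> n \<le> q \<Longrightarrow> z (Suc n) = z n * cis (- 2 * \<psi> n)"
    and lo: "\<And>n. p \<le> n \<Longrightarrow> n \<le> q \<Longrightarrow> \<theta> \<le> \<psi> n"
    and hi: "\<And>n. p \<le> n \<Longrightarrow> n \<le> q \<Longrightarrow> \<psi> n \<le> pi - \<theta>"
    and mono: "\<And>m n. p \<le> m \<Longrightarrow> m \<le> n \<Longrightarrow> n \<le> q \<Longrightarrow> \<psi> n \<le> \<psi> m"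
  shows "norm (\<Sum>n=p..q. z n) \<le> 1 + 3 / \<theta>"
proof -
  have tele: "norm (\<Sum>n=p..m. z n - z (Suc n)) \<le> 2" if "p \<le> m" for m
  proof -
    have "(\<Sum>n=p..m. z n - z (Suc n)) = z p - z (Suc m)"
      using that by (induction m rule: dec_induct) auto
    then show ?thesis using norm_triangle_ineq4[of "z p" "z (Suc m)"] nz by simp
  qed
  have eq: "z n = (1/2) * (z n - z (Suc n)) - (\<i>/2) * (of_real (cot (\<psi> n)) * (z n - z (Suc n)))"
    if "p \<le> n" "n \<le> q" for n
  proof -
    define c s where "c = cos (\<psi> n)" and "s = sin (\<psi> n)"
    have s: "s \<noteq> 0" unfolding s_def
      using lo[OF that] hi[OF that] assms(2) sin_gt_zero[of "\<psi> n"] by auto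
    have cs: "c\<^sup>2 + s\<^sup>2 = 1" by (simp add: c_def s_def)
    have "cis (- 2 * \<psi> n) = Complex (c\<^sup>2 - s\<^sup>2) (- 2 * s * c)"
      by (simp add: c_def s_def cis.ctr cos_double sin_double)
    then have "z (Suc n) = z n * Complex (c\<^sup>2 - s\<^sup>2) (- 2 * s * c)" using step that by simp
    moreover have "(1/2 - (\<i>/2) * of_real (c / s)) * (1 - Complex (c\<^sup>2 - s\<^sup>2) (- 2 * s * c)) = 1"
    proof -
      \<comment> \<open>Half-angle form: \<open>2 * s\<close> cancels, and the unit numbers
        \<open>s + i c\<close> and \<open>s - i c\<close> that remain are conjugate.\<close>
      have "1 - Complex (c\<^sup>2 - s\<^sup>2) (- 2 * s * c) = of_real (2 * s) * Complex s c"
        using cs by (simp add: complex_eq_iff power2_eq_square)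
      moreover have "1/2 - (\<i>/2) * of_real (c / s) = Complex s (- c) / of_real (2 * s)"
        using s by (simp add: complex_eq_iff)
      moreover have "Complex s (- c) * Complex s c = 1"
        using cs by (simp add: complex_eq_iff power2_eq_square)
      ultimately show ?thesis using s by simp
    qed
    ultimately have "z n * ((1/2 - (\<i>/2) * of_real (c / s)) * (1 - Complex (c\<^sup>2 - s\<^sup>2) (- 2 * s * c))) = z n"
      and "z (Suc n) = z n * Complex (c\<^sup>2 - s\<^sup>2) (- 2 * s * c)" by simp_all
    then show ?thesis by (simp add: cot_def c_def s_def algebra_simps)
  qed
  have "(\<Sum>n=p..q. z n) = (1/2) * (\<Sum>n=p..q. z n - z (Suc n))
      - (\<i>/2) * (\<Sum>n=p..q. of_real (cot (\<psi> n)) * (z n - z (Suc n)))"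
    unfolding sum_distrib_left sum_subtractf[symmetric] by (intro sum.cong refl eq) auto
  \<comment> \<open>Both \<open>\<psi>\<close> and \<open>cot\<close> decrease, so the weights
    increase; the last factor \<open>2\<close> bounds the telescoped sums. After halving, the two
    parts give \<open>1\<close> and \<open>3 / \<theta>\<close>.\<close>
  moreover have "norm (\<Sum>n=p..q. of_real (cot (\<psi> n)) * (z n - z (Suc n))) \<le> 3 * (1 / \<theta>) * 2"
  proof (rule norm_sum_monotone_weight_le)
    show "cot (\<psi> m) \<le> cot (\<psi> n)" if "p \<le> m" "m \<le> n" "n \<le> q" for m n
      using lo[of n] hi[of m] mono[OF that] assms(2) that by (intro cot_antimono) auto
    show "\<bar>cot (\<psi> n)\<bar> \<le> 1 / \<theta>" if "p \<le> n" "n \<le> q" for n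
      using that by (intro abs_cot_le_inverse assms lo hi)
  qed (use assms(1) tele in auto)
  moreover have "norm (\<Sum>n=p..q. z n - z (Suc n)) \<le> 2" using tele assms(1) by simp
  ultimately show ?thesis
    using norm_triangle_ineq4[of "(1/2) * (\<Sum>n=p..q. z n - z (Suc n))"
      "(\<i>/2) * (\<Sum>n=p..q. of_real (cot (\<psi> n)) * (z n - z (Suc n)))"]
    by (simp add: norm_mult norm_divide)
qed

section \<open>Intervals and spaced sets of naturals\<close>

lemma order_convex_nat_eq_atLeastAtMost:
  fixes B :: "nat set"
  assumes "finite B" "B \<noteq> {}" "\<And>a b n. a \<in> B \<Longrightarrow> b \<in> B \<Longrightarrow> a \<le> n \<Longrightarrow> n \<le> b \<Longrightarrow> n \<in> B"
  shows "B = {Min B..Max B}"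
proof
  show "B \<subseteq> {Min B..Max B}" using assms(1) by (auto intro: Min_le Max_ge)
  show "{Min B..Max B} \<subseteq> B"
    using assms(3)[OF Min_in[OF assms(1,2)] Max_in[OF assms(1,2)]] by (meson atLeastAtMost_iff subsetI)
qed

text \<open>Only the extremes matter: \<open>A\<close> lies between its minimum and maximum, whose
  distance is at most \<open>L / d\<close>. The \<open>+ 1\<close> accounts for both
  endpoints.\<close>

lemma card_le_of_spaced:
  fixes A :: "nat set" and f :: "nat \<Rightarrow> real"
  assumes "finite A" "0 < d" "0 \<le> L"
    and gap: "\<And>m n. m \<in> A \<Longrightarrow> n \<in> A \<Longrightarrow> m \<le> n \<Longrightarrow> d * real (n - m) \<le> f m - f n"
    and "\<And>n. n \<in> A \<Longrightarrow> x \<le> f n \<and> f n \<le> x + L"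
  shows "real (card A) \<le> L / d + 1"
proof (cases "A = {}")
  case True
  then show ?thesis using assms by simp
next
  case False
  let ?m = "Min A" and ?n = "Max A"
  have mem: "?m \<in> A" "?n \<in> A" using False assms(1) by auto
  have "card A \<le> card {?m..?n}" using assms(1) by (intro card_mono) auto
  moreover have "?m \<le> ?n" using mem assms(1) by simp
  ultimately have c: "real (card A) \<le> real (?n - ?m) + 1" by (simp add: Suc_diff_le)
  have "d * real (?n - ?m) \<le> L"
    using gap[OF mem \<open>?m \<le> ?n\<close>] assms(5)[OF mem(1)] assms(5)[OF mem(2)] by linarith
  then have "real (?n - ?m) \<le> L / d" using assms(2) by (simp add: field_simps)
  then show ?thesis using c by simp
qed

section \<open>Phase increments and the sum over one block\<close>

text \<open>Half the phase increment of \<open>n powr (- i t)\<close>, up to sign. Halving matches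
  the \<open>\<psi>\<close> of \<open>kusmin_landau\<close> and puts the resonances at multiples of
  \<open>pi\<close>.\<close>

definition half_step :: "real \<Rightarrow> nat \<Rightarrow> real" where
  "half_step t n = t / 2 * (ln (real n + 1) - ln (real n))"

lemma cis_ln_Suc:
  "cis (- t * ln (real (Suc n))) = cis (- t * ln (real n)) * cis (- 2 * half_step t n)"
  by (simp add: cis_mult half_step_def algebra_simps)

lemma half_step_le:
  assumes "0 \<le> t" "1 \<le> n"
  shows "half_step t n \<le> t / (2 * real n)"
proof -
  have "ln (real n + 1) - ln (real n) = ln (1 + 1 / real n)"
    using assms ln_div[of "real n + 1" "real n"] by (simp add: add_divide_distrib add.commute)
  also have "\<dots> \<le> 1 / real n" by (rule ln_add_one_self_le_self) simp
  finally have "t / 2 * (ln (real n + 1) - ln (real n)) \<le> t / 2 * (1 / real n)"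
    using assms(1) by (intro mult_left_mono) auto
  then show ?thesis by (simp add: half_step_def)
qed

lemma half_step_nonneg: "0 \<le> t \<Longrightarrow> 1 \<le> n \<Longrightarrow> 0 \<le> half_step t n"
  by (simp add: half_step_def)

text \<open>The difference is \<open>t / 2 * ln y\<close> for the \<open>y\<close> of the proof, and
  \<open>ln y\<close> is at least \<open>1 - 1 / y = 1 / (n + 1)^2\<close>.\<close>

lemma half_step_Suc_gap:
  assumes "0 \<le> t" "1 \<le> n"
  shows "t / (2 * (real n + 1)\<^sup>2) \<le> half_step t n - half_step t (Suc n)"
proof -
  define y where "y = (real n + 1)\<^sup>2 / (real n * (real n + 2))"
  have n: "0 < real n" using assms by simp
  then have y: "0 < y" by (simp add: y_def)
  have "1 - inverse y = ((real n + 1)\<^sup>2 - real n * (real n + 2)) / (real n + 1)\<^sup>2"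
    using n by (simp add: y_def diff_divide_distrib)
  also have "(real n + 1)\<^sup>2 - real n * (real n + 2) = 1" by (simp add: power2_eq_square algebra_simps)
  finally have "1 / (real n + 1)\<^sup>2 = 1 - inverse y" by simp
  also have "\<dots> \<le> ln y" using ln_le_minus_one[of "inverse y"] y by (simp add: ln_inverse)
  also have "ln y = 2 * ln (real n + 1) - ln (real n) - ln (real n + 2)"
    using n by (simp add: y_def ln_div ln_mult ln_realpow)
  finally have "t / 2 * (1 / (real n + 1)\<^sup>2) \<le> t / 2 * (2 * ln (real n + 1) - ln (real n) - ln (real n + 2))"
    using assms(1) by (intro mult_left_mono) auto
  then show ?thesis by (simp add: half_step_def algebra_simps)
qed

text \<open>Adds up the one-step gaps, which are smallest at the right end. \<open>N\<close> is real
  so that the block bound \<open>2 * t / (k + 1)\<close> can be inserted.\<close>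

lemma half_step_gap:
  assumes "0 \<le> t" "1 \<le> m" "m \<le> n" "real n \<le> N"
  shows "t / (2 * N\<^sup>2) * real (n - m) \<le> half_step t m - half_step t n"
  using assms(3,4)
proof (induction n rule: dec_induct)
  case base
  then show ?case by simp
next
  case (step n)
  have "t / (2 * N\<^sup>2) \<le> t / (2 * (real n + 1)\<^sup>2)"
    using step assms by (intro divide_left_mono mult_left_mono power_mono mult_pos_pos) auto
  also have "\<dots> \<le> half_step t n - half_step t (Suc n)"
    using step assms by (intro half_step_Suc_gap) auto
  finally have "t / (2 * N\<^sup>2) * (real (n - m) + 1) \<le> half_step t m - half_step t (Suc n)"
    using step.IH step.prems by (simp add: distrib_left)
  then show ?case using step.hyps by (simp add: Suc_diff_le add.commute)
qed

lemma half_step_antimono: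
  assumes "0 \<le> t" "1 \<le> m" "m \<le> n"
  shows "half_step t n \<le> half_step t m"
proof -
  have "0 \<le> t / (2 * (real n)\<^sup>2) * real (n - m)" using assms by simp
  then show ?thesis using half_step_gap[OF assms order_refl] by linarith
qed

text \<open>The cut-off \<open>\<theta> = (k + 1) / sqrt t\<close> balances the Kusmin-Landau bound \<open>1 / \<theta>\<close> against the
  number of terms whose phase increment is within \<open>\<theta>\<close> of a multiple of \<open>pi\<close>.\<close>
lemma norm_sum_cis_ln_block_le:
  fixes t :: real and k :: nat
  assumes t: "1 \<le> t" and p: "1 \<le> p" and q: "real q \<le> t"
  defines "A \<equiv> {n \<in> {p..q}. real k * pi \<le> half_step t n \<and> half_step t n < (real k + 1) * pi}"
  shows "norm (\<Sum>n\<in>A. cis (- t * ln (real n))) \<le> 19 * sqrt t / (real k + 1) + 3"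
proof -
  define \<theta> where "\<theta> = (real k + 1) / sqrt t"
  \<comment> \<open>The spacing that \<open>half_step_gap\<close> yields for
    \<open>N = 2 * t / (k + 1)\<close>.\<close>
  define d where "d = (real k + 1)\<^sup>2 / (8 * t)"
  let ?z = "\<lambda>n::nat. cis (- t * ln (real n))"
  have \<theta>: "0 < \<theta>" and d: "0 < d" using t by (auto simp: \<theta>_def d_def)
  have fin: "finite A" by (simp add: A_def)
  \<comment> \<open>For positive \<open>k\<close> this follows from
    \<open>k \<le> k * pi \<le> t / (2 * n)\<close>; the form with \<open>k + 1\<close> also covers
    \<open>k = 0\<close>, where \<open>n \<le> t\<close>.\<close>
  have N: "real n \<le> 2 * t / (real k + 1)" if "n \<in> A" for n
  proof (cases "k = 0")
    case True
    then show ?thesis using that q t by (simp add: A_def)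
  next
    case False
    have n: "1 \<le> n" using that p by (auto simp: A_def)
    have "real k * 1 \<le> real k * pi" using pi_gt3 by (intro mult_left_mono) auto
    also have "\<dots> \<le> t / (2 * real n)" using that half_step_le[of t n] n t by (auto simp: A_def)
    finally have "real k * (2 * real n) \<le> t" using n by (simp add: field_simps)
    moreover have "real n * 1 \<le> real n * real k" using False by (intro mult_left_mono) auto
    ultimately have "real n * (real k + 1) \<le> 2 * t" using t by (simp add: algebra_simps)
    then show ?thesis by (simp add: field_simps)
  qed
  have dN: "t / (2 * (2 * t / (real k + 1))\<^sup>2) = d"
    using t by (simp add: d_def field_simps power2_eq_square)
  have gap: "d * real (n - m) \<le> half_step t m - half_step t n" if "m \<in> A" "n \<in> A" "m \<le> n" for m n
    using half_step_gap[OF _ _ that(3) N[OF that(2)], of t] that t p unfolding dN by (auto simp: A_def)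
  \<comment> \<open>\<open>B\<close> is the range for Kusmin-Landau; \<open>L\<close> and
    \<open>U\<close> hold the terms near the lower and upper multiple of \<open>pi\<close>, with
    values in a window of length \<open>\<theta>\<close> each.\<close>
  define B where "B = {n \<in> A. real k * pi + \<theta> \<le> half_step t n \<and> half_step t n \<le> (real k + 1) * pi - \<theta>}"
  define L where "L = {n \<in> A. half_step t n < real k * pi + \<theta>}"
  define U where "U = {n \<in> A. (real k + 1) * pi - \<theta> < half_step t n}"
  have \<theta>d: "\<theta> / d = 8 * sqrt t / (real k + 1)"
  proof -
    have "\<theta> / d = 8 * (t / sqrt t) * ((real k + 1) / (real k + 1)\<^sup>2)"
      by (simp add: \<theta>_def d_def)
    also have "t / sqrt t = sqrt t" using t by (simp add: real_div_sqrt)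
    also have "(real k + 1) / (real k + 1)\<^sup>2 = 1 / (real k + 1)" by (simp add: power2_eq_square)
    finally show ?thesis by simp
  qed
  have cL: "real (card L) \<le> \<theta> / d + 1"
  proof (rule card_le_of_spaced[where f = "half_step t" and x = "real k * pi"])
    show "finite L" using fin by (simp add: L_def)
  qed (use \<theta> d gap in \<open>auto simp: L_def A_def\<close>)
  have cU: "real (card U) \<le> \<theta> / d + 1"
  proof (rule card_le_of_spaced[where f = "half_step t" and x = "(real k + 1) * pi - \<theta>"])
    show "finite U" using fin by (simp add: U_def)
  qed (use \<theta> d gap in \<open>auto simp: U_def A_def\<close>)
  have card_bound: "norm (\<Sum>n\<in>X. ?z n) \<le> real (card X)" for X
    using norm_sum[of ?z X] by simp
  have rest: "norm (\<Sum>n\<in>A - B. ?z n) \<le> 2 * (\<theta> / d + 1)"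
  proof -
    have "card (A - B) \<le> card (L \<union> U)"
      using fin by (intro card_mono) (auto simp: B_def L_def U_def)
    also have "\<dots> \<le> card L + card U" by (rule card_Un_le)
    finally have "real (card (A - B)) \<le> real (card L) + real (card U)"
      by (simp flip: of_nat_add)
    then show ?thesis using card_bound[of "A - B"] cL cU by simp
  qed
  have good: "norm (\<Sum>n\<in>B. ?z n) \<le> 1 + 3 / \<theta>"
  \<comment> \<open>If \<open>\<theta> > pi / 2\<close>, then \<open>B\<close> is empty and all
    terms of the block are merely counted.\<close>
  proof (cases "B = {}")
    case True
    then show ?thesis using \<theta> by simp
  next
    case False
    have finB: "finite B" using fin by (simp add: B_def)
    have conv: "n \<in> B" if "a \<in> B" "b \<in> B" "a \<le> n" "n \<le> b" for a b n
    proof -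
      have "1 \<le> a" using that p by (auto simp: B_def A_def)
      then have "half_step t n \<le> half_step t a" "half_step t b \<le> half_step t n"
        using half_step_antimono[of t a n] half_step_antimono[of t n b] that t by auto
      then show ?thesis using that by (auto simp: B_def A_def)
    qed
    have Beq: "B = {Min B..Max B}"
      by (rule order_convex_nat_eq_atLeastAtMost[OF finB False conv])
    have inB: "n \<in> B" if "Min B \<le> n" "n \<le> Max B" for n
      using that by (subst Beq) simp
    have "norm (\<Sum>n=Min B..Max B. ?z n) \<le> 1 + 3 / \<theta>"
    proof (rule kusmin_landau[where \<psi> = "\<lambda>n. half_step t n - real k * pi"])
      show "Min B \<le> Max B" using finB False by simp
      \<comment> \<open>Shifting by \<open>k * pi\<close> moves the increments into the range of
        \<open>kusmin_landau\<close>; doubled, the shift is a full number of turns.\<close>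
      show "?z (Suc n) = ?z n * cis (- 2 * (half_step t n - real k * pi))" for n
      proof -
        have "cis (- 2 * (half_step t n - real k * pi)) = cis (- 2 * half_step t n) * cis (2 * pi * real k)"
          by (simp add: cis_mult algebra_simps)
        also have "cis (2 * pi * real k) = 1" by (rule cis_multiple_2pi) simp
        finally show ?thesis by (simp only: cis_ln_Suc mult_1_right)
      qed
      show "half_step t n - real k * pi \<le> half_step t m - real k * pi"
        if "Min B \<le> m" "m \<le> n" "n \<le> Max B" for m n
      proof -
        have "m \<in> B" using that by (intro inB) auto
        then have "1 \<le> m" using p by (auto simp: B_def A_def)
        then show ?thesis using that half_step_antimono[of t m n] t by simp
      qed
      show "\<theta> \<le> half_step t n - real k * pi" if "Min B \<le> n" "n \<le> Max B" for n
        using inB[OF that] by (simp add: B_def)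
      show "half_step t n - real k * pi \<le> pi - \<theta>" if "Min B \<le> n" "n \<le> Max B" for n
        using inB[OF that] by (simp add: B_def algebra_simps)
    qed (use \<theta> in auto)
    then show ?thesis by (simp only: Beq[symmetric])
  qed
  have "(\<Sum>n\<in>A. ?z n) = (\<Sum>n\<in>A - B. ?z n) + (\<Sum>n\<in>B. ?z n)"
    using fin by (intro sum.subset_diff) (auto simp: B_def)
  then have "norm (\<Sum>n\<in>A. ?z n) \<le> 2 * (\<theta> / d + 1) + (1 + 3 / \<theta>)"
    using rest good norm_triangle_mono by metis
  also have "3 / \<theta> = 3 * sqrt t / (real k + 1)" by (simp add: \<theta>_def)
  \<comment> \<open>With \<open>r = sqrt t / (k + 1)\<close>, the two windows cost
    \<open>8 * r + 1\<close> each and the interval \<open>3 * r + 1\<close>.\<close>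
  also have "2 * (\<theta> / d + 1) + (1 + 3 * sqrt t / (real k + 1)) = 19 * sqrt t / (real k + 1) + 3"
  proof -
    have "2 * (8 * r + 1) + (1 + 3 * r) = 19 * r + 3" for r :: real by simp
    then show ?thesis unfolding \<theta>d times_divide_eq_right[symmetric] .
  qed
  finally show ?thesis .
qed

section \<open>Summation over the blocks and insertion of the weights\<close>

lemma harm_le_ln: "1 \<le> n \<Longrightarrow> harm n \<le> 1 + ln (real n)"
  using euler_mascheroni_sequence_decreasing[of 1 n] by (simp add: harm_def)

text \<open>From the threshold \<open>9\<close> on, rounding errors of size 1 are swallowed:
  \<open>sqrt t + 1\<close> is below both \<open>2 * sqrt t\<close> and \<open>t\<close>.\<close>

lemma sqrt_le_third:
  fixes t :: real
  assumes "9 \<le> t"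
  shows "3 \<le> sqrt t" and "sqrt t \<le> t / 3"
proof -
  show 3: "3 \<le> sqrt t" using assms by (intro real_le_rsqrt) simp
  have "3 * sqrt t \<le> sqrt t * sqrt t" using 3 assms by (intro mult_right_mono) auto
  then show "sqrt t \<le> t / 3" using assms by simp
qed

lemma ln_ge_1:
  fixes t :: real
  assumes "3 \<le> t"
  shows "1 \<le> ln t"
  using assms exp_le by (simp add: ln_ge_iff)

text \<open>Starting at \<open>sqrt t\<close> keeps the block index at most \<open>sqrt t\<close>.
  The main terms of the blocks form a harmonic sum, the source of the logarithm; the constants add
  up to \<open>O(sqrt t)\<close>.\<close>

lemma norm_sum_cis_ln_le:
  fixes t :: real
  assumes t: "9 \<le> t" and p: "sqrt t \<le> real p" and q: "real q \<le> t"
  shows "norm (\<Sum>n=p..q. cis (- t * ln (real n))) \<le> 44 * sqrt t * ln t"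
proof -
  let ?z = "\<lambda>n::nat. cis (- t * ln (real n))"
  define K where "K = nat \<lfloor>sqrt t\<rfloor>"
  define \<kappa> where "\<kappa> n = nat \<lfloor>half_step t n / pi\<rfloor>" for n
  have p1: "1 \<le> p" using p sqrt_le_third[OF t] by simp
  have K: "real K \<le> sqrt t" unfolding K_def using t by simp
  have \<kappa>K: "\<kappa> n \<le> K" if "n \<in> {p..q}" for n
  proof -
    have n: "sqrt t \<le> real n" "1 \<le> n" using that p p1 by auto
    have "half_step t n \<le> t / (2 * real n)" using half_step_le n t by simp
    also have "\<dots> \<le> t / sqrt t"
      using n t by (intro divide_left_mono mult_pos_pos) auto
    also have "\<dots> = sqrt t" using t by (simp add: real_div_sqrt)
    also have "\<dots> \<le> sqrt t * pi" using pi_gt3 t mult_left_mono[of 1 pi "sqrt t"] by simp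
    finally have "half_step t n / pi \<le> sqrt t" by (simp add: field_simps)
    then show ?thesis unfolding \<kappa>_def K_def by (intro nat_mono floor_mono)
  qed
  have block: "{n \<in> {p..q}. \<kappa> n = k}
      = {n \<in> {p..q}. real k * pi \<le> half_step t n \<and> half_step t n < (real k + 1) * pi}" for k
  proof -
    have "\<kappa> n = k \<longleftrightarrow> real k * pi \<le> half_step t n \<and> half_step t n < (real k + 1) * pi"
      if "n \<in> {p..q}" for n
    proof -
      \<comment> \<open>Rules out negative floors, which \<open>nat\<close> would send to block
        0.\<close>
      have "0 \<le> half_step t n / pi" using half_step_nonneg[of t n] that p1 t by simp
      then have "\<kappa> n = k \<longleftrightarrow> \<lfloor>half_step t n / pi\<rfloor> = int k" unfolding \<kappa>_def by auto
      also have "\<dots> \<longleftrightarrow> real k \<le> half_step t n / pi \<and> half_step t n / pi < real k + 1"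
        by (simp add: floor_eq_iff)
      finally show ?thesis by (simp add: field_simps)
    qed
    then show ?thesis by blast
  qed
  have "(\<Sum>n=p..q. ?z n) = (\<Sum>k\<le>K. \<Sum>n\<in>{n \<in> {p..q}. \<kappa> n = k}. ?z n)"
    using \<kappa>K by (intro sum.group[symmetric]) auto
  then have "norm (\<Sum>n=p..q. ?z n) \<le> (\<Sum>k\<le>K. 19 * sqrt t / (real k + 1) + 3)"
    unfolding block
    by (simp only:) (intro sum_norm_le norm_sum_cis_ln_block_le, use t q p1 in auto)
  also have "\<dots> = 19 * sqrt t * harm (Suc K) + 3 * (real K + 1)"
  proof -
    have "harm (Suc K) = (\<Sum>k\<le>K. 1 / (real k + 1))"
      unfolding harm_def using sum.shift_bounds_cl_Suc_ivl[of "\<lambda>k. inverse (real k)" 0 K]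
      by (simp add: atMost_atLeast0 field_simps)
    then show ?thesis by (simp add: sum.distrib sum_distrib_left)
  qed
  also have "\<dots> \<le> 19 * sqrt t * (2 * ln t) + 3 * (2 * sqrt t)"
  proof -
    have "harm (Suc K) \<le> 1 + ln (real (Suc K))" by (rule harm_le_ln) simp
    also have "ln (real (Suc K)) \<le> ln t"
      using K sqrt_le_third[OF t] t by (intro ln_mono) auto
    finally have "harm (Suc K) \<le> 2 * ln t" using ln_ge_1[of t] t by simp
    then show ?thesis using K sqrt_le_third[OF t] t by (intro add_mono mult_left_mono) auto
  qed
  \<comment> \<open>\<open>44 = 38 + 6\<close>, with \<open>1 \<le> ln t\<close> absorbing the
    second term.\<close>
  also have "\<dots> \<le> 44 * sqrt t * ln t"
    using mult_left_mono[of 1 "ln t" "sqrt t"] ln_ge_1[of t] t by simp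
  finally show ?thesis .
qed

lemma norm_sum_powr_cis_ln_le:
  fixes t \<sigma> :: real
  assumes t: "9 \<le> t" and \<sigma>: "0 \<le> \<sigma>" "\<sigma> < 1"
  shows "norm (\<Sum>n=1..nat \<lfloor>t\<rfloor>. of_real (real n powr - \<sigma>) * cis (- t * ln (real n)))
    \<le> 134 * t powr ((1 - \<sigma>) / 2) * ln t"
proof -
  let ?z = "\<lambda>n::nat. cis (- t * ln (real n))"
  let ?w = "\<lambda>n::nat. of_real (real n powr - \<sigma>) * cis (- t * ln (real n))"
  define q where "q = nat \<lfloor>t\<rfloor>"
  \<comment> \<open>The largest integer strictly below \<open>sqrt t\<close>, so that the tail
    starts at \<open>Suc M\<close>, where \<open>norm_sum_cis_ln_le\<close> applies.\<close>
  define M where "M = nat \<lceil>sqrt t\<rceil> - 1"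
  note s = sqrt_le_third[OF t]
  have s0: "0 < sqrt t" using t by simp
  have q: "real q \<le> t" "t < real q + 1" unfolding q_def using t by linarith+
  have M: "real M < sqrt t" "sqrt t \<le> real (Suc M)" "1 \<le> M" unfolding M_def using s by linarith+
  have Mq: "M < q" using M q s t by linarith
  have split: "(\<Sum>n=1..q. ?w n) = (\<Sum>n=1..M. ?w n) + (\<Sum>n=Suc M..q. ?w n)"
    using sum.ub_add_nat[of 1 M ?w "q - M"] Mq M by simp
  have ln1: "1 \<le> ln t" using ln_ge_1 t by simp
  have pw: "sqrt t powr (1 - \<sigma>) = t powr ((1 - \<sigma>) / 2)"
    using t by (simp add: powr_half_sqrt[symmetric] powr_powr)
  have "norm (\<Sum>n=1..M. ?w n) \<le> (\<Sum>n=1..M. sqrt t powr (1 - \<sigma>) * inverse (real n))"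
  proof (rule sum_norm_le)
    fix n assume n: "n \<in> {1..M}"
    \<comment> \<open>Splitting off \<open>1 / n\<close> leaves a harmonic sum: this costs a
      logarithm but keeps the constant independent of \<open>\<sigma>\<close>, even near 1.\<close>
    have "real n powr - \<sigma> = real n powr (1 - \<sigma>) * inverse (real n)"
      using n by (simp add: powr_diff powr_minus field_simps)
    also have "\<dots> \<le> sqrt t powr (1 - \<sigma>) * inverse (real n)"
      using n M \<sigma> by (intro mult_right_mono powr_mono2) auto
    finally show "norm (?w n) \<le> sqrt t powr (1 - \<sigma>) * inverse (real n)"
      by (simp add: norm_mult)
  qed
  also have "\<dots> = sqrt t powr (1 - \<sigma>) * harm M"
    by (simp add: harm_def sum_distrib_left)
  also have "\<dots> \<le> sqrt t powr (1 - \<sigma>) * (2 * ln t)"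
  proof (intro mult_left_mono)
    have "harm M \<le> 1 + ln (real M)" using M(3) by (rule harm_le_ln)
    also have "ln (real M) \<le> ln t" using M s t by (intro ln_mono) auto
    finally show "harm M \<le> 2 * ln t" using ln1 by simp
  qed simp
  finally have head: "norm (\<Sum>n=1..M. ?w n) \<le> 2 * (t powr ((1 - \<sigma>) / 2) * ln t)"
    by (simp add: pw)
  \<comment> \<open>The weights are negated because partial summation was set up for nondecreasing
    ones; the norm is unaffected.\<close>
  have "norm (\<Sum>n=Suc M..q. of_real (- (real n powr - \<sigma>)) * ?z n)
      \<le> 3 * (sqrt t powr - \<sigma>) * (44 * sqrt t * ln t)"
  proof (rule norm_sum_monotone_weight_le)
    show "Suc M \<le> q" using Mq by simp
    show "- (real m powr - \<sigma>) \<le> - (real n powr - \<sigma>)" if "Suc M \<le> m" "m \<le> n" "n \<le> q" for m n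
      using that \<sigma> by (auto intro!: powr_mono2')
    show "\<bar>- (real n powr - \<sigma>)\<bar> \<le> sqrt t powr - \<sigma>" if "Suc M \<le> n" "n \<le> q" for n
      using that \<sigma> M s0 by (auto intro!: powr_mono2')
    show "norm (\<Sum>n=Suc M..m. ?z n) \<le> 44 * sqrt t * ln t" if "Suc M \<le> m" "m \<le> q" for m
      using that q M by (intro norm_sum_cis_ln_le t) auto
  qed
  also have "\<dots> = 132 * ((sqrt t powr - \<sigma> * sqrt t) * ln t)" by simp
  also have "sqrt t powr - \<sigma> * sqrt t = t powr ((1 - \<sigma>) / 2)"
    unfolding pw[symmetric] using s0 by (simp add: powr_diff powr_minus field_simps)
  also have "norm (\<Sum>n=Suc M..q. of_real (- (real n powr - \<sigma>)) * ?z n) = norm (\<Sum>n=Suc M..q. ?w n)"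
    by (simp add: sum_negf)
  finally have tail: "norm (\<Sum>n=Suc M..q. ?w n) \<le> 132 * (t powr ((1 - \<sigma>) / 2) * ln t)" .
  show ?thesis
    using norm_triangle_ineq[of "\<Sum>n=1..M. ?w n" "\<Sum>n=Suc M..q. ?w n"] head tail
    unfolding q_def[symmetric] split by linarith
qed

section \<open>The double sum as a squared modulus and the final bound\<close>

lemma inverse_of_nat_powr_Complex:
  assumes "1 \<le> n"
  shows "1 / (of_nat n :: complex) powr Complex \<sigma> t
    = of_real (real n powr - \<sigma>) * cis (- t * ln (real n))"
proof -
  have "(of_nat n :: complex) powr Complex \<sigma> t = exp (Complex \<sigma> t * of_real (ln (real n)))"
    using assms by (simp add: powr_def Ln_of_nat)
  then have "1 / (of_nat n :: complex) powr Complex \<sigma> t = exp (- (Complex \<sigma> t * of_real (ln (real n))))"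
    by (simp add: exp_minus inverse_eq_divide)
  also have "\<dots> = of_real (real n powr - \<sigma>) * cis (- t * ln (real n))"
    using assms by (simp add: exp_eq_polar powr_def)
  finally show ?thesis .
qed

lemma norm_double_sum_eq:
  fixes t \<sigma> :: real
  shows "norm (\<Sum>m=1..N. \<Sum>n=1..N.
            1 / ((of_nat m :: complex) powr (Complex \<sigma> t) * (of_nat n :: complex) powr (cnj (Complex \<sigma> t))))
    = (norm (\<Sum>n=1..N. of_real (real n powr - \<sigma>) * cis (- t * ln (real n))))\<^sup>2"
proof -
  let ?w = "\<lambda>n::nat. of_real (real n powr - \<sigma>) * cis (- t * ln (real n))"
  have "1 / ((of_nat m :: complex) powr (Complex \<sigma> t) * (of_nat n :: complex) powr (cnj (Complex \<sigma> t)))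
      = ?w m * cnj (?w n)" if "1 \<le> m" "1 \<le> n" for m n
  proof -
    \<comment> \<open>Conjugation replaces \<open>t\<close> by \<open>- t\<close>, so the same
      closed form serves both factors.\<close>
    have "cnj (?w n) = of_real (real n powr - \<sigma>) * cis (- (- t) * ln (real n))"
      by (simp add: cis_cnj)
    also have "\<dots> = 1 / (of_nat n :: complex) powr Complex \<sigma> (- t)"
      using inverse_of_nat_powr_Complex[OF that(2), of \<sigma> "- t"] by simp
    also have "Complex \<sigma> (- t) = cnj (Complex \<sigma> t)" by (simp add: complex_eq_iff)
    finally have n: "cnj (?w n) = 1 / (of_nat n :: complex) powr cnj (Complex \<sigma> t)" .
    show ?thesis unfolding n inverse_of_nat_powr_Complex[OF that(1), symmetric] by simp
  qed
  then have "(\<Sum>m=1..N. \<Sum>n=1..N.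
            1 / ((of_nat m :: complex) powr (Complex \<sigma> t) * (of_nat n :: complex) powr (cnj (Complex \<sigma> t))))
      = (\<Sum>m=1..N. \<Sum>n=1..N. ?w m * cnj (?w n))"
    by (intro sum.cong refl) auto
  also have "\<dots> = (\<Sum>m=1..N. ?w m) * cnj (\<Sum>n=1..N. ?w n)"
    unfolding cnj_sum by (simp only: sum_product)
  finally show ?thesis by (simp only: norm_mult complex_mod_cnj power2_eq_square)
qed

theorem lemma3p1:
  fixes \<sigma> :: real
  assumes "0 \<le> \<sigma>" and "\<sigma> < 1"
  shows "(\<lambda>t::real. \<Sum>m = 1..nat \<lfloor>t\<rfloor>. \<Sum>n = 1..nat \<lfloor>t\<rfloor>.
            1 / ((of_nat m :: complex) powr (Complex \<sigma> t) * (of_nat n :: complex) powr (cnj (Complex \<sigma> t))))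
         \<in> O[at_top](\<lambda>t. complex_of_real
              (if \<sigma> \<le> 1 / 2 then t powr (3 / 2 - 5 / 3 * \<sigma>) * ln t
               else t powr (4 / 3 - 4 / 3 * \<sigma>) * ln t))"
proof -
  define e where "e = (if \<sigma> \<le> 1 / 2 then 3 / 2 - 5 / 3 * \<sigma> else 4 / 3 - 4 / 3 * \<sigma>)"
  \<comment> \<open>The slack in the exponent: \<open>1/2 - 2/3 * \<sigma>\<close>, at least
    \<open>1/6\<close>, in the first case and \<open>(1 - \<sigma>) / 3\<close> in the
    second.\<close>
  define \<epsilon> where "\<epsilon> = e - (1 - \<sigma>)"
  have \<epsilon>: "0 < \<epsilon>" using assms by (auto simp: \<epsilon>_def e_def)
  have "norm (\<Sum>m = 1..nat \<lfloor>t\<rfloor>. \<Sum>n = 1..nat \<lfloor>t\<rfloor>.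
            1 / ((of_nat m :: complex) powr (Complex \<sigma> t) * (of_nat n :: complex) powr (cnj (Complex \<sigma> t))))
      \<le> 134\<^sup>2 / \<epsilon> * norm (complex_of_real (t powr e * ln t))" if t: "9 \<le> t" for t
  proof -
    have ln0: "0 \<le> ln t" using t by simp
    have "(norm (\<Sum>n=1..nat \<lfloor>t\<rfloor>. of_real (real n powr - \<sigma>) * cis (- t * ln (real n))))\<^sup>2
        \<le> (134 * t powr ((1 - \<sigma>) / 2) * ln t)\<^sup>2"
      using norm_sum_powr_cis_ln_le[OF t assms] by (intro power_mono) auto
    also have "\<dots> = 134\<^sup>2 * (t powr (1 - \<sigma>) * ln t * ln t)"
    proof -
      have "(t powr ((1 - \<sigma>) / 2))\<^sup>2 = t powr (1 - \<sigma>)"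
        by (simp add: power2_eq_square flip: powr_add)
      then show ?thesis by (simp add: power_mult_distrib power2_eq_square[of "ln t"])
    qed
    \<comment> \<open>One of the two logarithms is traded for
      \<open>t powr \<epsilon> / \<epsilon>\<close>; this is where the constant comes to depend on
      \<open>\<sigma>\<close>.\<close>
    also have "\<dots> \<le> 134\<^sup>2 * (t powr (1 - \<sigma>) * ln t * (t powr \<epsilon> / \<epsilon>))"
      using ln_powr_bound[of t \<epsilon>] t \<epsilon> ln0 by (intro mult_left_mono) auto
    also have "\<dots> = 134\<^sup>2 / \<epsilon> * (t powr e * ln t)"
    proof -
      have "t powr e = t powr (1 - \<sigma>) * t powr \<epsilon>" by (simp add: \<epsilon>_def flip: powr_add)
      then show ?thesis by simp
    qed
    finally show ?thesis unfolding norm_double_sum_eq using ln0 by (simp add: norm_mult)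
  qed
  then have "(\<lambda>t::real. \<Sum>m = 1..nat \<lfloor>t\<rfloor>. \<Sum>n = 1..nat \<lfloor>t\<rfloor>.
            1 / ((of_nat m :: complex) powr (Complex \<sigma> t) * (of_nat n :: complex) powr (cnj (Complex \<sigma> t))))
         \<in> O[at_top](\<lambda>t. complex_of_real (t powr e * ln t))"
    by (intro bigoI[where c = "134\<^sup>2 / \<epsilon>"] eventually_mono[OF eventually_ge_at_top[of 9]])
  then show ?thesis unfolding e_def by (cases "\<sigma> \<le> 1 / 2") (simp_all only: if_True if_False)
qed

end
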